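(* If $G$ is a bridgeless connected graph of order $n$ with diameter $2$, then $trc(G)\leq n-1$.
   Context: All graphs are finite, simple and undirected. A total-coloring assigns colors to all vertices and edges; a path is total-rainbow if its edges and internal vertices receive pairwise distinct colors; $trc(G)$ is the minimum number of colors in a total-coloring of the connected graph $G$ such that every two distinct vertices are joined by a total-rainbow path. *)

theory Defs
  imports Main
begin

definition simple_graph :: "'a set \<Rightarrow> 'a set set \<Rightarrow> bool" where
  "simple_graph V E \<longleftrightarrow> finite V \<and> (\<forall>e\<in>E. e \<subseteq> V \<and> card e = 2)"

text \<open>A path is represented by the list of its vertices in order.\<close>

fun path_edges :: "'a list \<Rightarrow> 'a set list" where
  "path_edges (u # v # p) = {u, v} # path_edges (v # p)"
| "path_edges _ = []"

definition internal_vertices :: "'a list \<Rightarrow> 'a list" where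
  "internal_vertices p = butlast (tl p)"

definition path_between :: "'a set \<Rightarrow> 'a set set \<Rightarrow> 'a \<Rightarrow> 'a list \<Rightarrow> 'a \<Rightarrow> bool" where
  "path_between V E u p v \<longleftrightarrow>
     p \<noteq> [] \<and> hd p = u \<and> last p = v \<and> distinct p \<and> set p \<subseteq> V \<and> set (path_edges p) \<subseteq> E"

definition graph_connected :: "'a set \<Rightarrow> 'a set set \<Rightarrow> bool" where
  "graph_connected V E \<longleftrightarrow> V \<noteq> {} \<and> (\<forall>u\<in>V. \<forall>v\<in>V. \<exists>p. path_between V E u p v)"

definition graph_components :: "'a set \<Rightarrow> 'a set set \<Rightarrow> 'a set set" where
  "graph_components V E = V // {(u, v). u \<in> V \<and> v \<in> V \<and> (\<exists>p. path_between V E u p v)}"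

definition bridge :: "'a set \<Rightarrow> 'a set set \<Rightarrow> 'a set \<Rightarrow> bool" where
  "bridge V E e \<longleftrightarrow>
     e \<in> E \<and> card (graph_components V (E - {e})) > card (graph_components V E)"

definition bridgeless :: "'a set \<Rightarrow> 'a set set \<Rightarrow> bool" where
  "bridgeless V E \<longleftrightarrow> \<not> (\<exists>e. bridge V E e)"

text \<open>Meaningful only when some path joins the two vertices.\<close>

definition graph_dist :: "'a set \<Rightarrow> 'a set set \<Rightarrow> 'a \<Rightarrow> 'a \<Rightarrow> nat" where
  "graph_dist V E u v =
     (LEAST d. \<exists>p. path_between V E u p v \<and> length (path_edges p) = d)"

text \<open>Meaningful only for finite, nonempty, connected graphs.\<close>

definition graph_diameter :: "'a set \<Rightarrow> 'a set set \<Rightarrow> nat" where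
  "graph_diameter V E = Max {graph_dist V E u v | u v. u \<in> V \<and> v \<in> V}"

text \<open>
  A total-coloring is a function on the disjoint union of vertices (\<open>Inl\<close>) and
  edges (\<open>Inr\<close>), of which only the values on \<open>V <+> E\<close> matter. It need not be proper.
\<close>

definition total_rainbow :: "('a + 'a set \<Rightarrow> nat) \<Rightarrow> 'a list \<Rightarrow> bool" where
  "total_rainbow c p \<longleftrightarrow>
     distinct (map (c \<circ> Inr) (path_edges p) @ map (c \<circ> Inl) (internal_vertices p))"

definition total_rainbow_connecting ::
    "'a set \<Rightarrow> 'a set set \<Rightarrow> ('a + 'a set \<Rightarrow> nat) \<Rightarrow> bool" where
  "total_rainbow_connecting V E c \<longleftrightarrow>
     (\<forall>u\<in>V. \<forall>v\<in>V. u \<noteq> v \<longrightarrow> (\<exists>p. path_between V E u p v \<and> total_rainbow c p))"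

text \<open>
  Meaningful only for finite connected graphs, where an injective coloring shows that
  the minimum is attained.
\<close>

definition trc :: "'a set \<Rightarrow> 'a set set \<Rightarrow> nat" where
  "trc V E =
     (LEAST k. \<exists>c. total_rainbow_connecting V E c \<and> card (c ` (V <+> E)) = k)"

end

theory Submission
  imports Defs
begin

text \<open>
  Take nonadjacent \<open>u\<close>, \<open>v\<close> with a common neighbour \<open>w\<close>. Since \<open>uw\<close> is not a bridge, \<open>u\<close>
  has a further neighbour \<open>x\<close>, so \<open>ux\<close> and \<open>vw\<close> are disjoint edges. Label the vertices by
  residues modulo \<open>n - 2\<close> so that only the two ends of \<open>ux\<close> and the two ends of \<open>vw\<close> share a
  label. Colour each edge with the sum of the labels of its ends, and all vertices with one
  extra colour. Two edges \<open>aw\<close>, \<open>wb\<close> then get the same colour only if \<open>a\<close> and \<open>b\<close> have the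
  same label, hence only if \<open>a\<close>, \<open>b\<close> are equal or adjacent; so every path of length two
  joining nonadjacent vertices is total-rainbow.
\<close>

lemma path_between_edge:
  assumes "simple_graph V E" "{a, b} \<in> E"
  shows "path_between V E a [a, b] b"
proof -
  have "{a, b} \<subseteq> V" "card {a, b} = 2"
    using assms by (auto simp: simple_graph_def)
  then show ?thesis
    using assms by (auto simp: path_between_def card_insert_if split: if_splits)
qed

lemma path_of_length_le_2:
  assumes "path_between V E a p b" "length (path_edges p) \<le> 2"
  obtains "a = b" | "{a, b} \<in> E" | w where "path_between V E a [a, w, b] b"
proof (cases p rule: path_edges.cases)
  case (1 y z q)
  show thesis
  proof (cases q)
    case Nil
    then show thesis using assms 1 that by (auto simp: path_between_def)
  next
    case (Cons s q')
    then have "q' = []" using assms 1 by (cases q') auto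
    then show thesis using assms 1 Cons that by (auto simp: path_between_def)
  qed
qed (use assms that in \<open>auto simp: path_between_def\<close>)

lemma graph_dist_attained:
  assumes "graph_connected V E" "a \<in> V" "b \<in> V"
  obtains p where "path_between V E a p b" "length (path_edges p) = graph_dist V E a b"
proof -
  have "\<exists>d p. path_between V E a p b \<and> length (path_edges p) = d"
    using assms unfolding graph_connected_def by blast
  then have "\<exists>p. path_between V E a p b \<and> length (path_edges p) = graph_dist V E a b"
    unfolding graph_dist_def by (rule LeastI_ex)
  then show thesis using that by blast
qed

lemma graph_dist_le_length:
  assumes "path_between V E a p b"
  shows "graph_dist V E a b \<le> length (path_edges p)"
  unfolding graph_dist_def using assms by (blast intro: Least_le)

text \<open>Needed because \<open>graph_diameter\<close> is a \<open>Max\<close>, which is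
  informative only on a finite set.\<close>

lemma finite_graph_dists:
  assumes "finite V"
  shows "finite {graph_dist V E u v | u v. u \<in> V \<and> v \<in> V}"
proof -
  have "{graph_dist V E u v | u v. u \<in> V \<and> v \<in> V} = (\<lambda>(u, v). graph_dist V E u v) ` (V \<times> V)"
    by auto
  then show ?thesis using assms by simp
qed

lemma graph_dist_le_diameter:
  assumes "finite V" "a \<in> V" "b \<in> V"
  shows "graph_dist V E a b \<le> graph_diameter V E"
  unfolding graph_diameter_def by (rule Max_ge) (use assms finite_graph_dists in auto)

lemma graph_diameter_attained:
  assumes "finite V" "V \<noteq> {}"
  obtains a b where "a \<in> V" "b \<in> V" "graph_dist V E a b = graph_diameter V E"
proof -
  have "graph_diameter V E \<in> {graph_dist V E u v | u v. u \<in> V \<and> v \<in> V}"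
    unfolding graph_diameter_def
    by (rule Max_in[OF finite_graph_dists[OF assms(1)]]) (use assms(2) in blast)
  then show thesis using that by auto
qed

lemma card_graph_components_connected:
  assumes "graph_connected V E"
  shows "card (graph_components V E) = 1"
proof -
  have "{(u, v). u \<in> V \<and> v \<in> V \<and> (\<exists>p. path_between V E u p v)} = V \<times> V" "V \<noteq> {}"
    using assms by (auto simp: graph_connected_def)
  then have "graph_components V E = {V}"
    by (auto simp: graph_components_def quotient_def)
  then show ?thesis by simp
qed

text \<open>Deleting the only edge at \<open>u\<close> isolates \<open>u\<close>. Its class then
  differs from that of \<open>w\<close>, which gives at least two components, while the connected
  graph has just one.\<close>

lemma pendant_edge_bridge:
  assumes G: "simple_graph V E" "graph_connected V E"
    and uw: "{u, w} \<in> E"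
    and pendant: "\<And>x. {u, x} \<in> E \<Longrightarrow> x = w"
  shows "bridge V E {u, w}"
proof -
  let ?E = "E - {{u, w}}"
  let ?R = "{(a, b). a \<in> V \<and> b \<in> V \<and> (\<exists>p. path_between V ?E a p b)}"
  have "{u, w} \<subseteq> V" "card {u, w} = 2" "finite V"
    using G uw by (auto simp: simple_graph_def)
  then have V: "u \<in> V" "w \<in> V" "u \<noteq> w" "finite V"
    by (auto simp: card_insert_if split: if_splits)
  \<comment> \<open>A longer path would have to start with an edge at \<open>u\<close>, but
    \<open>{u, w}\<close> is the only such edge and is absent from \<open>?E\<close>.\<close>
  have "b = u" if "path_between V ?E u p b" for p b
    using that pendant by (cases p rule: path_edges.cases) (auto simp: path_between_def)
  then have "?R `` {u} \<subseteq> {u}" by auto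
  moreover have "w \<in> ?R `` {w}"
    using V by (auto simp: path_between_def intro!: exI[of _ "[w]"])
  ultimately have "?R `` {u} \<noteq> ?R `` {w}" using V(3) by blast
  then have "2 = card {?R `` {u}, ?R `` {w}}" by simp
  also have "\<dots> \<le> card (graph_components V ?E)"
  proof (rule card_mono)
    show "finite (graph_components V ?E)"
      using V by (auto simp: graph_components_def intro!: finite_quotient)
    show "{?R `` {u}, ?R `` {w}} \<subseteq> graph_components V ?E"
      unfolding graph_components_def using V by (blast intro: quotientI)
  qed
  finally show ?thesis
    using uw card_graph_components_connected[OF G(2)] by (simp add: bridge_def)
qed

lemma two_disjoint_edges:
  assumes G: "simple_graph V E" "graph_connected V E"
    and "bridgeless V E" "graph_diameter V E = 2"
  obtains u x v w where "{u, x} \<in> E" "{v, w} \<in> E" "distinct [u, x, v, w]"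
proof -
  have "finite V" "V \<noteq> {}"
    using G by (auto simp: simple_graph_def graph_connected_def)
  then obtain u v where uv: "u \<in> V" "v \<in> V" "graph_dist V E u v = 2"
    using graph_diameter_attained assms(4) by metis
  \<comment> \<open>The trivial path would give distance 0, and in the next step an edge would give
    distance at most 1, against distance 2.\<close>
  have "u \<noteq> v"
    using uv graph_dist_le_length[of V E u "[u]" u] by (auto simp: path_between_def)
  have "{u, v} \<notin> E"
    using uv graph_dist_le_length[OF path_between_edge[OF G(1)]] by force
  obtain p where "path_between V E u p v" "length (path_edges p) \<le> 2"
    using graph_dist_attained[OF G(2)] uv by (metis order_refl)
  then obtain w where w: "path_between V E u [u, w, v] v"
    using \<open>u \<noteq> v\<close> \<open>{u, v} \<notin> E\<close> by (auto elim: path_of_length_le_2)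
  then have "{u, w} \<in> E" by (simp add: path_between_def)
  then obtain x where x: "{u, x} \<in> E" "x \<noteq> w"
    using pendant_edge_bridge[OF G] assms(3) unfolding bridgeless_def by blast
  then have "u \<noteq> x" using G by (auto simp: simple_graph_def)
  moreover have "x \<noteq> v" using x \<open>{u, v} \<notin> E\<close> by auto
  ultimately show thesis
    using that[of u x v w] w x by (auto simp: path_between_def insert_commute)
qed

lemma labelling_identifying_two_pairs:
  assumes "finite V" "{u, x, v, w} \<subseteq> V" "distinct [u, x, v, w]"
  obtains f :: "'a \<Rightarrow> nat" where "\<And>a. a \<in> V \<Longrightarrow> f a < card V - 2"
    and "\<And>a b. a \<in> V \<Longrightarrow> b \<in> V \<Longrightarrow> f a = f b \<Longrightarrow> a \<noteq> b \<Longrightarrow> {a, b} = {u, x} \<or> {a, b} = {v, w}"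
proof -
  let ?W = "V - {x, w}"
  have "card ?W = card V - 2"
    using assms by (simp add: card_Diff_subset)
  then obtain g :: "'a \<Rightarrow> nat" where g: "inj_on g ?W" "g ` ?W = {..<card V - 2}"
    using assms ex_bij_betw_finite_nat[of ?W] by (auto simp: bij_betw_def atLeast0LessThan)
  \<comment> \<open>\<open>h\<close> retracts \<open>V\<close> onto \<open>?W\<close> by merging
    \<open>x\<close> into \<open>u\<close> and \<open>w\<close> into \<open>v\<close>. As
    \<open>g\<close> is injective on \<open>?W\<close>, the labelling \<open>g \<circ> h\<close>
    identifies these two pairs and nothing else.\<close>
  define h where "h a = (if a = x then u else if a = w then v else a)" for a
  have h: "h a \<in> ?W" if "a \<in> V" for a
    using that assms by (auto simp: h_def)
  show thesis
  proof (rule that[of "g \<circ> h"])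
    show "(g \<circ> h) a < card V - 2" if "a \<in> V" for a
      using h[OF that] g by auto
    show "{a, b} = {u, x} \<or> {a, b} = {v, w}"
      if "a \<in> V" "b \<in> V" "(g \<circ> h) a = (g \<circ> h) b" "a \<noteq> b" for a b
    proof -
      have "h a = h b"
        using that g(1) h by (auto dest: inj_onD)
      then show ?thesis
        using \<open>a \<noteq> b\<close> assms(3) by (auto simp: h_def split: if_splits)
    qed
  qed
qed

text \<open>Cancellation of \<open>k\<close> modulo \<open>m\<close>, with \<open>k\<close> as the
  label of the middle vertex of a path of length two. The proof passes to integers because
  subtraction on \<open>nat\<close> truncates.\<close>

lemma add_mod_eq_imp_eq:
  fixes a b k m :: nat
  assumes "(a + k) mod m = (k + b) mod m" "a < m" "b < m"
  shows "a = b"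
proof -
  have "(int a + int k) mod int m = (int b + int k) mod int m"
    using assms(1) by (metis add.commute of_nat_add of_nat_mod)
  then have "int a mod int m = int b mod int m"
    by (metis add_diff_cancel_right' mod_diff_left_eq)
  then show ?thesis using assms by simp
qed

theorem theorem4p1:
  fixes V :: "'a set" and E :: "'a set set" and n :: nat
  assumes "simple_graph V E"
    and "graph_connected V E"
    and "bridgeless V E"
    and "card V = n"
    and "graph_diameter V E = 2"
  shows "trc V E \<le> n - 1"
proof -
  have "finite V" using assms(1) by (simp add: simple_graph_def)
  obtain u x v w where M: "{u, x} \<in> E" "{v, w} \<in> E" "distinct [u, x, v, w]"
    using two_disjoint_edges assms by metis
  then have sub: "{u, x, v, w} \<subseteq> V"
    using assms(1) by (auto simp: simple_graph_def)
  then have "card {u, x, v, w} \<le> n"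
    using card_mono \<open>finite V\<close> assms(4) by metis
  \<comment> \<open>This bound makes the modulus \<open>n - 2\<close> positive, so that residues
    really lie below it.\<close>
  then have n: "4 \<le> n" using M(3) by simp
  obtain f :: "'a \<Rightarrow> nat" where f: "\<And>a. a \<in> V \<Longrightarrow> f a < n - 2"
    and f_eq: "\<And>a b. a \<in> V \<Longrightarrow> b \<in> V \<Longrightarrow> f a = f b \<Longrightarrow> a \<noteq> b \<Longrightarrow>
      {a, b} = {u, x} \<or> {a, b} = {v, w}"
    using labelling_identifying_two_pairs[OF \<open>finite V\<close> sub M(3)] assms(4) by metis
  \<comment> \<open>Edges get residues \<open>0, ..., n - 3\<close>, which leaves
    \<open>n - 2\<close> as a fresh colour for the vertices. One vertex colour suffices, since the
    paths used have at most one internal vertex.\<close>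
  define c :: "'a + 'a set \<Rightarrow> nat" where
    "c = case_sum (\<lambda>_. n - 2) (\<lambda>e. (\<Sum>a\<in>e. f a) mod (n - 2))"
  have "\<exists>p. path_between V E a p b \<and> total_rainbow c p"
    if ab: "a \<in> V" "b \<in> V" "a \<noteq> b" for a b
  proof (cases "{a, b} \<in> E")
    case True
    then have "path_between V E a [a, b] b"
      using path_between_edge assms(1) by metis
    then show ?thesis
      by (auto simp: total_rainbow_def internal_vertices_def)
  next
    case False
    obtain p where "path_between V E a p b" "length (path_edges p) \<le> 2"
      using graph_dist_attained[OF assms(2)] graph_dist_le_diameter[OF \<open>finite V\<close>] ab assms(5)
      by metis
    then obtain y where y: "path_between V E a [a, y, b] b"
      using ab False by (auto elim: path_of_length_le_2)
    \<comment> \<open>Equal labels would make \<open>{a, b}\<close> one of the edges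
      \<open>{u, x}\<close> and \<open>{v, w}\<close>, but \<open>a\<close> and \<open>b\<close> are
      nonadjacent.\<close>
    have "f a \<noteq> f b"
      using f_eq[of a b] ab False M by auto
    then have "(f a + f y) mod (n - 2) \<noteq> (f y + f b) mod (n - 2)"
      using add_mod_eq_imp_eq f ab by metis
    \<comment> \<open>Neither edge of the path shares the colour of the internal vertex
      \<open>y\<close>.\<close>
    moreover have "k mod (n - 2) \<noteq> n - 2" for k
      using n mod_less_divisor[of "n - 2" k] by linarith
    ultimately have "total_rainbow c [a, y, b]"
      using y by (simp add: total_rainbow_def internal_vertices_def c_def path_between_def)
    then show ?thesis using y by blast
  qed
  then have "total_rainbow_connecting V E c"
    by (simp add: total_rainbow_connecting_def)
  then have "trc V E \<le> card (c ` (V <+> E))"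
    unfolding trc_def by (blast intro: Least_le)
  also have "\<dots> \<le> card {..<n - 1}"
  proof (rule card_mono)
    have "k mod (n - 2) < n - 1" for k
      using n mod_less_divisor[of "n - 2" k] by linarith
    then show "c ` (V <+> E) \<subseteq> {..<n - 1}"
      using n by (auto simp: c_def)
  qed simp
  finally show ?thesis by simp
qed

end
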